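(* Let $T:\mathbb{R}[x]\to\mathbb{R}[x]$ be a linear operator, written as $$T=\sum_{k=0}^\infty Q_k(x)D^k,$$ where $Q_k(x)\in\mathbb{R}[x]$ and $\deg(Q_k(x))\le k$ for every $k\in\mathbb{N}_0$. For each $n\in\mathbb{N}_0$ define the sequence $$\{b_{n,k}\}_{k=0}^\infty:=\left\{\sum_{j=0}^k\binom{k}{j}Q_{j+n}^{(j)}(0)\right\}_{k=0}^\infty$$ and define the classical diagonal differential operator $T_n$ by $T_n[x^k]:=b_{n,k}x^k$ for all $k\in\mathbb{N}_0$. Then $$T=\sum_{n=0}^\infty T_nD^n.$$ Furthermore, this representation of $T$ (as a sum $\sum_{n=0}^\infty T_nD^n$ with each $T_n$ a classical diagonal differential operator) is unique.
   Context: $\mathbb{N}_0=\{0,1,2,\ldots\}$ and $D:=\frac{d}{dx}$. Every linear operator $T:\mathbb{R}[x]\to\mathbb{R}[x]$ has a unique representation $T=\sum_{k=0}^\infty Q_k(x)D^k$ with $Q_k\in\mathbb{R}[x]$; applied to any polynomial, all the sums involved are finite. $Q_k^{(j)}$ denotes the $j$-th derivative of $Q_k$. The zero polynomial is regarded as satisfying every degree bound. A classical diagonal differential operator is a linear operator $S:\mathbb{R}[x]\to\mathbb{R}[x]$ such that $S[x^k]=c_kx^k$ for every $k\in\mathbb{N}_0$, for some sequence of real numbers $\{c_k\}_{k=0}^\infty$. *)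

theory Defs
  imports "HOL-Computational_Algebra.Polynomial" "HOL-Library.Groups_Big_Fun"
begin

text \<open>
  HOL's class-based predicate for linear maps is not available for polynomials, so linearity over
  the reals is expressed with the scalar multiplication \<^const>\<open>smult\<close> of polynomials.
\<close>

abbreviation linear_op :: "(real poly \<Rightarrow> real poly) \<Rightarrow> bool" where
  "linear_op \<equiv> Vector_Spaces.linear smult smult"

text \<open>
  The operator \<open>\<Sum>n. A n D^n\<close>, where \<open>D\<close> is \<^const>\<open>pderiv\<close> and the product is composition.
  \<^const>\<open>Sum_any\<close> sums over the indices with a nonzero term; for linear \<open>A n\<close> these are
  finitely many (lemma \<open>finite_support_op_series\<close> below), so its default value for infinite
  supports never occurs.
\<close>

definition op_series :: "(nat \<Rightarrow> real poly \<Rightarrow> real poly) \<Rightarrow> real poly \<Rightarrow> real poly" where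
  "op_series A p = Sum_any (\<lambda>n. A n ((pderiv ^^ n) p))"

definition classical_diagonal :: "(real poly \<Rightarrow> real poly) \<Rightarrow> bool" where
  "classical_diagonal S \<longleftrightarrow>
     linear_op S \<and> (\<exists>c :: nat \<Rightarrow> real. \<forall>k. S (monom 1 k) = smult (c k) (monom 1 k))"

text \<open>
  The linear operator with \<open>x^k \<mapsto> c k x^k\<close>, given by its action on coefficients; lemma
  \<open>diag_op_unique\<close> below shows that it is the only such operator.
\<close>

definition diag_op :: "(nat \<Rightarrow> real) \<Rightarrow> real poly \<Rightarrow> real poly" where
  "diag_op c p = (\<Sum>k\<le>degree p. monom (c k * coeff p k) k)"

definition b_seq :: "(nat \<Rightarrow> real poly) \<Rightarrow> nat \<Rightarrow> nat \<Rightarrow> real" where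
  "b_seq Q n k = (\<Sum>j\<le>k. real (k choose j) * poly ((pderiv ^^ j) (Q (j + n))) 0)"

lemma linear_op_iff:
  "linear_op S \<longleftrightarrow> (\<forall>p q. S (p + q) = S p + S q) \<and> (\<forall>a p. S (smult a p) = smult a (S p))"
proof -
  have "vector_space (smult :: real \<Rightarrow> real poly \<Rightarrow> real poly)"
    by unfold_locales (simp_all add: smult_add_right smult_add_left)
  then show ?thesis
    by (auto simp: Vector_Spaces.linear_def module_hom_def module_hom_axioms_def module_iff_vector_space)
qed

lemma linear_op_mult: "linear_op (\<lambda>p. q * p)"
  by (simp add: linear_op_iff distrib_left)

lemma pderiv_funpow_eq_0: "degree p < n \<Longrightarrow> (pderiv ^^ n) p = 0" for p :: "real poly"
proof (induction n arbitrary: p)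
  case (Suc n)
  show ?case
  proof (cases "degree p = 0")
    case True
    then have "pderiv p = 0" by (simp add: pderiv_eq_0_iff)
    moreover have "(pderiv ^^ n) 0 = (0 :: real poly)" by (induction n) auto
    ultimately show ?thesis by (simp add: funpow_Suc_right del: funpow.simps)
  next
    case False
    then have "degree (pderiv p) < n" using Suc.prems by (simp add: degree_pderiv)
    then show ?thesis using Suc.IH by (simp add: funpow_Suc_right del: funpow.simps)
  qed
qed simp

lemma support_op_series:
  assumes "\<And>n. linear_op (A n)"
  shows "{n. A n ((pderiv ^^ n) p) \<noteq> 0} \<subseteq> {..degree p}"
proof -
  have "A n 0 = 0" for n
    using assms[of n] unfolding linear_op_iff by (metis smult_0_left)
  then show ?thesis by (auto intro: ccontr simp: pderiv_funpow_eq_0)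
qed

lemma finite_support_op_series:
  assumes "\<And>n. linear_op (A n)"
  shows "finite {n. A n ((pderiv ^^ n) p) \<noteq> 0}"
  using support_op_series[OF assms] finite_atMost by (rule finite_subset)

lemma op_series_eq_sum:
  assumes "\<And>n. linear_op (A n)"
  shows "op_series A p = (\<Sum>n\<le>degree p. A n ((pderiv ^^ n) p))"
  unfolding op_series_def
  by (rule Sum_any.expand_superset[OF finite_atMost support_op_series[OF assms]])

lemma coeff_diag_op: "coeff (diag_op c p) k = c k * coeff p k"
  by (auto simp: diag_op_def coeff_sum coeff_eq_0)

lemma linear_op_diag_op: "linear_op (diag_op c)"
  by (auto simp: linear_op_iff poly_eq_iff coeff_diag_op algebra_simps)

lemma diag_op_monom: "diag_op c (monom 1 k) = smult (c k) (monom 1 k)"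
  by (auto simp: poly_eq_iff coeff_diag_op)

lemma classical_diagonal_diag_op: "classical_diagonal (diag_op c)"
  unfolding classical_diagonal_def using linear_op_diag_op diag_op_monom by blast

lemma diag_op_unique:
  assumes "linear_op S" and "\<And>k. S (monom 1 k) = smult (c k) (monom 1 k)"
  shows "S = diag_op c"
proof
  fix p :: "real poly"
  have add: "S (p + q) = S p + S q" and scale: "S (smult a p) = smult a (S p)" for a p q
    using assms(1) by (auto simp: linear_op_iff)
  have S0: "S 0 = 0" using scale[of 0 0] by simp
  have Ssum: "S (sum f I) = (\<Sum>i\<in>I. S (f i))" if "finite I" for f and I :: "nat set"
    using that by (induction I) (auto simp: S0 add)
  have Smon: "S (monom a k) = monom (c k * a) k" for a k
    using scale[of a "monom 1 k"] assms(2)[of k] by (simp add: smult_monom mult.commute)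
  have "S p = S (\<Sum>k\<le>degree p. monom (coeff p k) k)"
    by (simp add: poly_as_sum_of_monoms)
  also have "\<dots> = diag_op c p"
    by (simp add: Ssum Smon diag_op_def)
  finally show "S p = diag_op c p" .
qed

end

theory Submission
  imports Defs
begin

text \<open>
  The reason behind the expansion is that \<open>x^i D^i\<close> is itself a classical diagonal operator: it
  multiplies \<open>x^r\<close> by the falling factorial \<open>(r choose i) i!\<close>.  Write \<open>q k i\<close> for the coefficients
  of \<open>Q k\<close>.  Since \<open>Q k\<close> has degree at most \<open>k\<close>, every term of \<open>Q k D^k\<close> factors as
  \<open>q k i x^i D^k = (q k i x^i D^i) D^(k-i)\<close> with \<open>i \<le> k\<close>.  Collecting the terms with the same
  \<open>n = k - i\<close> gives \<open>T = \<Sum>n. (\<Sum>i. q (i+n) i x^i D^i) D^n\<close>, and the inner sum is the diagonal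
  operator with eigenvalues \<open>\<Sum>i\<le>r. (r choose i) i! q (i+n) i\<close>, which is \<open>b_seq Q n r\<close> because
  \<open>i! q (i+n) i\<close> is the \<open>i\<close>-th derivative of \<open>Q (i+n)\<close> at \<open>0\<close>.  The lemma
  \<open>diag_op_b_seq_eq_sum\<close> identifies the inner sum; \<open>op_series_mult_eq_op_series_diag\<close> regroups.

  Uniqueness holds because each term lowers degrees by a different amount: in
  \<open>\<Sum>n. diag_op (c n) D^n\<close> applied to \<open>x^(r+n)\<close>, the coefficient of \<open>x^r\<close> is a nonzero multiple of
  \<open>c n r\<close>, so the operator determines all the eigenvalues.
\<close>

lemma pochhammer_eq_choose_mult_fact:
  assumes "i \<le> r"
  shows "pochhammer (real (Suc (r - i))) i = real (r choose i) * fact i"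
  using assms gbinomial_pochhammer'[of "real r" i]
  by (simp add: binomial_gbinomial of_nat_diff add.commute)

lemma coeff_monom_mult_higher_pderiv:
  "coeff (monom 1 i * (pderiv ^^ i) f) r = real (r choose i) * fact i * coeff f r"
  for f :: "real poly"
proof (cases "i \<le> r")
  case True
  then show ?thesis
    using pochhammer_eq_choose_mult_fact[OF True]
    by (simp add: coeff_monom_mult coeff_higher_pderiv)
next
  case False
  then show ?thesis
    by (simp add: coeff_monom_mult binomial_eq_0)
qed

lemma b_seq_eq_sum_coeff:
  "b_seq Q n r = (\<Sum>i\<le>r. real (r choose i) * fact i * coeff (Q (i + n)) i)"
  unfolding b_seq_def
  by (intro sum.cong refl)
    (simp add: poly_0_coeff_0 coeff_higher_pderiv pochhammer_fact mult.assoc)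

text \<open>
  The diagonal operator with eigenvalues \<open>b_seq Q n\<close> is the formal series
  \<open>\<Sum>i. q (i+n) i x^i D^i\<close>; on polynomials of degree at most \<open>M\<close> the terms with \<open>i > M\<close> vanish.
\<close>

lemma diag_op_b_seq_eq_sum:
  assumes "degree f \<le> M"
  shows "diag_op (b_seq Q n) f =
    (\<Sum>i\<le>M. smult (coeff (Q (i + n)) i) (monom 1 i * (pderiv ^^ i) f))"
proof (rule poly_eqI)
  fix r
  show "coeff (diag_op (b_seq Q n) f) r =
    coeff (\<Sum>i\<le>M. smult (coeff (Q (i + n)) i) (monom 1 i * (pderiv ^^ i) f)) r"
  proof (cases "r \<le> M")
    case True
    \<comment> \<open>The binomial coefficient kills the terms with \<open>r < i \<le> M\<close>.\<close>
    have "(\<Sum>i\<le>M. real (r choose i) * fact i * coeff (Q (i + n)) i) = b_seq Q n r"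
      unfolding b_seq_eq_sum_coeff
      by (rule sum.mono_neutral_right) (use True in \<open>auto simp: binomial_eq_0\<close>)
    then have "coeff (diag_op (b_seq Q n) f) r =
        (\<Sum>i\<le>M. real (r choose i) * fact i * coeff (Q (i + n)) i) * coeff f r"
      by (simp add: coeff_diag_op)
    then show ?thesis
      by (simp add: coeff_sum coeff_monom_mult_higher_pderiv sum_distrib_left mult_ac)
  next
    case False
    then have "coeff f r = 0"
      using assms by (simp add: coeff_eq_0)
    then show ?thesis
      by (simp add: coeff_diag_op coeff_sum coeff_monom_mult_higher_pderiv)
  qed
qed

lemma mult_eq_sum_monom_mult:
  fixes p q :: "real poly"
  assumes "degree q \<le> k"
  shows "q * p = (\<Sum>i\<le>k. smult (coeff q i) (monom 1 i * p))"
proof -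
  have "q * p = (\<Sum>i\<le>k. monom (coeff q i) i) * p"
    using poly_as_sum_of_monoms'[OF assms] by simp
  also have "\<dots> = (\<Sum>i\<le>k. smult (coeff q i) (monom 1 i * p))"
    unfolding sum_distrib_right
    by (intro sum.cong refl) (simp add: smult_monom flip: mult_smult_left)
  finally show ?thesis .
qed

text \<open>
  The degree bound confines the monomials \<open>x^i D^k\<close> of the left-hand side to \<open>i \<le> k\<close>, so a
  triangular double sum over \<open>(k, i)\<close> can be reindexed by \<open>n = k - i\<close>.
\<close>

lemma op_series_mult_eq_op_series_diag:
  assumes "\<And>k. degree (Q k) \<le> k"
  shows "op_series (\<lambda>k p. Q k * p) = op_series (\<lambda>n. diag_op (b_seq Q n))"
proof
  fix p :: "real poly"
  define N where "N = degree p"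
  define g where
    "g n i = smult (coeff (Q (i + n)) i) (monom 1 i * (pderiv ^^ (i + n)) p)" for n i
  have rev: "(\<Sum>i\<le>k. g (k - i) i) = (\<Sum>i\<le>k. g i (k - i))" for k
    by (rule sum.reindex_bij_witness[where i = "\<lambda>i. k - i" and j = "\<lambda>i. k - i"]) auto
  have "op_series (\<lambda>k p. Q k * p) p = (\<Sum>k\<le>N. \<Sum>i\<le>k. g (k - i) i)"
    unfolding op_series_eq_sum[OF linear_op_mult] N_def
    by (intro sum.cong refl) (simp add: mult_eq_sum_monom_mult[OF assms] g_def)
  also have "\<dots> = (\<Sum>k\<le>N. \<Sum>i\<le>k. g i (k - i))"
    by (simp only: rev)
  also have "\<dots> = (\<Sum>(n, i)\<in>{(n, i). n + i \<le> N}. g n i)"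
    by (rule sum.triangle_reindex_eq[symmetric])
  also have "{(n, i). n + i \<le> N} = Sigma {..N} (\<lambda>n. {..N - n})"
    by auto
  also have "(\<Sum>(n, i)\<in>\<dots>. g n i) = (\<Sum>n\<le>N. \<Sum>i\<le>N - n. g n i)"
    by (rule sum.Sigma[symmetric]) auto
  also have "\<dots> = (\<Sum>n\<le>N. diag_op (b_seq Q n) ((pderiv ^^ n) p))"
    by (intro sum.cong refl, subst diag_op_b_seq_eq_sum)
      (auto simp: N_def g_def degree_higher_pderiv funpow_add)
  also have "\<dots> = op_series (\<lambda>n. diag_op (b_seq Q n)) p"
    by (simp add: op_series_eq_sum[OF linear_op_diag_op] N_def)
  finally show "op_series (\<lambda>k p. Q k * p) p = op_series (\<lambda>n. diag_op (b_seq Q n)) p" .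
qed

lemma coeff_op_series_diag_monom:
  "coeff (op_series (\<lambda>n. diag_op (c n)) (monom 1 (r + n))) r = c n r * pochhammer (real (Suc r)) n"
proof -
  have "coeff (op_series (\<lambda>n. diag_op (c n)) (monom 1 (r + n))) r =
      (\<Sum>m\<le>r + n. if m = n then c n r * pochhammer (real (Suc r)) n else 0)"
    unfolding op_series_eq_sum[OF linear_op_diag_op] coeff_sum
    by (intro sum.cong) (auto simp: degree_monom_eq coeff_diag_op coeff_higher_pderiv)
  then show ?thesis
    by simp
qed

lemma op_series_diag_inject:
  assumes "op_series (\<lambda>n. diag_op (c n)) = op_series (\<lambda>n. diag_op (d n))"
  shows "c = d"
proof (intro ext)
  fix n r
  have "c n r * pochhammer (real (Suc r)) n = d n r * pochhammer (real (Suc r)) n"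
    by (metis assms coeff_op_series_diag_monom)
  moreover have "pochhammer (real (Suc r)) n > 0"
    by (rule pochhammer_pos) simp
  ultimately show "c n r = d n r"
    by simp
qed

theorem theorem17:
  fixes T :: "real poly \<Rightarrow> real poly" and Q :: "nat \<Rightarrow> real poly"
  assumes "linear_op T"
    and "T = op_series (\<lambda>k p. Q k * p)"
    and "\<And>k. degree (Q k) \<le> k"
  shows "(\<forall>n. classical_diagonal (diag_op (b_seq Q n))) \<and>
         T = op_series (\<lambda>n. diag_op (b_seq Q n)) \<and>
         (\<forall>S. (\<forall>n. classical_diagonal (S n)) \<and> T = op_series S \<longrightarrow>
              S = (\<lambda>n. diag_op (b_seq Q n)))"
proof (intro conjI allI impI)
  show "classical_diagonal (diag_op (b_seq Q n))" for n
    by (rule classical_diagonal_diag_op)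
  show T: "T = op_series (\<lambda>n. diag_op (b_seq Q n))"
    unfolding assms(2) by (rule op_series_mult_eq_op_series_diag[OF assms(3)])
  fix S
  assume S: "(\<forall>n. classical_diagonal (S n)) \<and> T = op_series S"
  then have "\<forall>n. \<exists>c. S n = diag_op c"
    unfolding classical_diagonal_def by (meson diag_op_unique)
  then obtain c where c: "S = (\<lambda>n. diag_op (c n))"
    by metis
  then have "op_series (\<lambda>n. diag_op (c n)) = op_series (\<lambda>n. diag_op (b_seq Q n))"
    using S T by simp
  then show "S = (\<lambda>n. diag_op (b_seq Q n))"
    using c op_series_diag_inject by blast
qed

end
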